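(* Let $\Omega\subset\mathbb{R}^n$ ($n\ge 2$) be a bounded domain, let $h\in C(\Omega)\cap L^\infty(\Omega)$ with $h\le 0$, let $\lambda\in C(\Omega)$ with $\lambda\ge 0$, and let $0<m<3$. Let $u,v\in C(\overline{\Omega})$ be nonnegative functions such that, in the viscosity sense, \[ \Delta_\infty u-\lambda(x)u_+^m\ge h(x)\quad\text{in }\Omega,\qquad \Delta_\infty v-\lambda(x)v_+^m\le h(x)\quad\text{in }\Omega . \] Let $F:=\{x\in\Omega:\lambda(x)=0\}$. If $u\le v$ on $\partial\Omega\cup F$, then $u\le v$ in $\Omega$.
   Context: The infinity Laplacian is $\Delta_\infty w=\langle D^2w\,Dw,Dw\rangle=\sum_{i,j}\partial_i w\,\partial_{ij}w\,\partial_j w$, and $t_+=\max\{t,0\}$. Viscosity sense: $u\in C(\Omega)$ satisfies $\Delta_\infty u-\lambda u_+^m\ge h$ (is a viscosity subsolution) if, whenever $\varphi\in C^2(\Omega)$ and $u-\varphi$ has a local maximum at $x_0\in\Omega$, one has $\Delta_\infty\varphi(x_0)\ge\lambda(x_0)(u(x_0)_+)^m+h(x_0)$. It satisfies $\Delta_\infty u-\lambda u_+^m\le h$ (is a viscosity supersolution) if, whenever $\varphi\in C^2(\Omega)$ and $u-\varphi$ has a local minimum at $x_0\in\Omega$, one has $\Delta_\infty\varphi(x_0)\le\lambda(x_0)(u(x_0)_+)^m+h(x_0)$. *)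

theory Defs
  imports "HOL-Analysis.Analysis"
begin

definition gradient :: "(real^'n \<Rightarrow> real) \<Rightarrow> real^'n \<Rightarrow> real^'n" where
  "gradient f x = (\<chi> i. frechet_derivative f (at x) (axis i 1))"

(* The entry (i, j) of the Hessian is the j-th partial derivative of the i-th partial derivative. *)
definition hessian :: "(real^'n \<Rightarrow> real) \<Rightarrow> real^'n \<Rightarrow> real^'n^'n" where
  "hessian f x = jacobian (gradient f) (at x)"

(* Intended for open S. Continuity of f and of its gradient follow from differentiability;
   the values of f outside S are irrelevant, since all derivatives are taken at points of S. *)
definition C2_on :: "(real^'n) set \<Rightarrow> (real^'n \<Rightarrow> real) \<Rightarrow> bool" where
  "C2_on S f \<longleftrightarrow>
     (\<forall>x\<in>S. f differentiable at x) \<and>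
     (\<forall>x\<in>S. gradient f differentiable at x) \<and>
     continuous_on S (hessian f)"

definition inf_laplacian :: "(real^'n \<Rightarrow> real) \<Rightarrow> real^'n \<Rightarrow> real" where
  "inf_laplacian w x = (hessian w x *v gradient w x) \<bullet> gradient w x"

definition local_max_at :: "(real^'n) set \<Rightarrow> (real^'n \<Rightarrow> real) \<Rightarrow> real^'n \<Rightarrow> bool" where
  "local_max_at S f x0 \<longleftrightarrow> x0 \<in> S \<and> (\<exists>r>0. \<forall>x\<in>S \<inter> ball x0 r. f x \<le> f x0)"

definition local_min_at :: "(real^'n) set \<Rightarrow> (real^'n \<Rightarrow> real) \<Rightarrow> real^'n \<Rightarrow> bool" where
  "local_min_at S f x0 \<longleftrightarrow> x0 \<in> S \<and> (\<exists>r>0. \<forall>x\<in>S \<inter> ball x0 r. f x0 \<le> f x)"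

(* Viscosity sub- and supersolutions of the equation
   inf_laplacian u - lam * (max u 0) powr m = h in S.
   Note that 0 powr m = 0, the intended value of the power for m > 0. *)
definition viscosity_subsolution ::
  "(real^'n) set \<Rightarrow> (real^'n \<Rightarrow> real) \<Rightarrow> real \<Rightarrow> (real^'n \<Rightarrow> real) \<Rightarrow> (real^'n \<Rightarrow> real) \<Rightarrow> bool" where
  "viscosity_subsolution S lam m h u \<longleftrightarrow>
     continuous_on S u \<and>
     (\<forall>\<phi> x0. C2_on S \<phi> \<longrightarrow> local_max_at S (\<lambda>x. u x - \<phi> x) x0 \<longrightarrow>
        inf_laplacian \<phi> x0 \<ge> lam x0 * (max (u x0) 0) powr m + h x0)"

definition viscosity_supersolution ::
  "(real^'n) set \<Rightarrow> (real^'n \<Rightarrow> real) \<Rightarrow> real \<Rightarrow> (real^'n \<Rightarrow> real) \<Rightarrow> (real^'n \<Rightarrow> real) \<Rightarrow> bool" where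
  "viscosity_supersolution S lam m h u \<longleftrightarrow>
     continuous_on S u \<and>
     (\<forall>\<phi> x0. C2_on S \<phi> \<longrightarrow> local_min_at S (\<lambda>x. u x - \<phi> x) x0 \<longrightarrow>
        inf_laplacian \<phi> x0 \<le> lam x0 * (max (u x0) 0) powr m + h x0)"

end

theory Submission
  imports Defs
begin

text \<open>
  The proof avoids doubling of variables and the theorem on sums of Crandall and Ishii. It
  compares \<open>u\<close> and \<open>v\<close> at a finite scale \<open>\<epsilon>\<close>, after the argument of Armstrong and Smart for
  infinity harmonic functions.

  Suppose that \<open>u - v\<close> has a positive maximum over the closure of \<open>\<Omega>\<close>. Near the points where
  \<open>u - v\<close> is large one is away from the boundary and from the zeros of \<open>\<lambda>\<close>, and there
  \<open>\<lambda> u^m + h\<close> exceeds \<open>\<lambda> v^m + h\<close> by a fixed amount. Let \<open>u\<^sup>\<epsilon>\<close> be the maximum of \<open>u\<close> and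
  \<open>v\<^sub>\<epsilon>\<close> the minimum of \<open>v\<close> over closed balls of radius \<open>\<epsilon>\<close>, and let \<open>x0\<close> maximise
  \<open>u\<^sup>\<epsilon> - v\<^sub>\<epsilon>\<close>. For small \<open>\<epsilon>\<close> there is a constant \<open>c\<close>, which may be taken different from zero,
  such that on the ball of radius \<open>2 \<epsilon>\<close> about \<open>x0\<close> the infinity Laplacian of \<open>u\<close> is greater
  than \<open>c\<close> and that of \<open>v\<close> less than \<open>c\<close>. Put \<open>w = - v\<close>, so that the infinity Laplacian of
  \<open>w\<close> is greater than \<open>- c\<close>. Interchanging \<open>u\<close> and \<open>w\<close>, one may assume \<open>c > 0\<close>.

  The one-dimensional functions \<open>G\<close> with \<open>G' ^ 2 * G'' = c\<close>, that is \<open>G' = (a + 3 c r) ^ (1/3)\<close>,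
  play the role of cones: if the infinity Laplacian of \<open>u\<close> exceeds \<open>c\<close> and \<open>u \<le> u(x0) + G(R)\<close> on
  the closed ball of radius \<open>R\<close> about \<open>x0\<close>, then \<open>u(x) \<le> u(x0) + G(\<bar>x - x0\<bar>)\<close> there, where
  \<open>G(0) = 0\<close> (lemma \<open>barrier_comparison\<close>).
  Choosing the parameter \<open>a\<close> so that \<open>G\<close> has the same increment over \<open>[0, 2 \<epsilon>]\<close> as the
  maximal one of \<open>u\<close>, one bounds the increment of \<open>u\<close> from the centre to its maximum over the
  ball of radius \<open>\<epsilon>\<close> from above, and the one from there to the maximum over the ball of radius
  \<open>2 \<epsilon>\<close> from below, by the corresponding increments of \<open>G\<close> (lemmas \<open>increments_pos\<close> and
  \<open>increments_neg\<close>). For \<open>c > 0\<close> such a parameter exists because \<open>u\<close> must grow at least as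
  fast as the barrier with \<open>a = 0\<close> (lemma \<open>growth_ge_barrier\<close>). For the negative constant \<open>- c\<close> the
  barrier is constant from the radius on at which its slope has dropped to zero.

  The maximality of \<open>x0\<close> bounds the outer increment of each of \<open>u\<close>, \<open>w\<close> by the inner
  increment of the other (lemma \<open>enveloped_difference_max\<close>). With the bounds by the barriers this
  contradicts the convexity of \<open>t ^ (4/3)\<close> (lemma \<open>increments_not_dominated\<close>).
\<close>

section \<open>Radial polynomials as test functions\<close>

text \<open>A polynomial of degree two in the squared distance from \<open>z\<close>. Unlike a general function of
  the distance it is smooth at \<open>z\<close> too, so it is a test function on any domain.\<close>
definition radial_quartic :: "real \<Rightarrow> real \<Rightarrow> real^'n \<Rightarrow> real^'n \<Rightarrow> real" where
  "radial_quartic \<alpha> \<beta> z x = \<alpha> * ((x - z) \<bullet> (x - z)) + \<beta> * ((x - z) \<bullet> (x - z))\<^sup>2"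

lemma radial_quartic_has_derivative:
  "(radial_quartic \<alpha> \<beta> z has_derivative
     (\<lambda>k. (2 * \<alpha> + 4 * \<beta> * ((x - z) \<bullet> (x - z))) * ((x - z) \<bullet> k))) (at x)"
  unfolding radial_quartic_def
  by (auto intro!: derivative_eq_intros simp: inner_commute algebra_simps power2_eq_square)

lemma gradient_radial_quartic:
  "gradient (radial_quartic \<alpha> \<beta> z) x =
     (2 * \<alpha> + 4 * \<beta> * ((x - z) \<bullet> (x - z))) *\<^sub>R (x - z)"
  unfolding gradient_def frechet_derivative_at[OF radial_quartic_has_derivative, symmetric]
  by (simp add: vec_eq_iff inner_axis)

lemma gradient_radial_quartic_has_derivative:
  "(gradient (radial_quartic \<alpha> \<beta> z) has_derivative
     (\<lambda>k. (2 * \<alpha> + 4 * \<beta> * ((x - z) \<bullet> (x - z))) *\<^sub>R k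
        + (8 * \<beta> * ((x - z) \<bullet> k)) *\<^sub>R (x - z))) (at x)"
  unfolding gradient_radial_quartic[abs_def]
  by (auto intro!: derivative_eq_intros simp: inner_commute algebra_simps)

lemma hessian_radial_quartic:
  "hessian (radial_quartic \<alpha> \<beta> z) x =
     (\<chi> i j. (2 * \<alpha> + 4 * \<beta> * ((x - z) \<bullet> (x - z))) * (axis j 1 $ i)
        + 8 * \<beta> * ((x - z) $ j) * ((x - z) $ i))"
  unfolding hessian_def jacobian_def
    frechet_derivative_at[OF gradient_radial_quartic_has_derivative, symmetric] matrix_def
  by (simp add: vec_eq_iff inner_axis)

lemma C2_on_radial_quartic: "C2_on UNIV (radial_quartic \<alpha> \<beta> z)"
  unfolding C2_on_def
proof (intro conjI ballI)
  show "radial_quartic \<alpha> \<beta> z differentiable at x" for x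
    using radial_quartic_has_derivative by (blast intro: differentiableI)
  show "gradient (radial_quartic \<alpha> \<beta> z) differentiable at x" for x
    using gradient_radial_quartic_has_derivative by (blast intro: differentiableI)
  show "continuous_on UNIV (hessian (radial_quartic \<alpha> \<beta> z))"
    unfolding hessian_radial_quartic[abs_def]
    by (intro continuous_intros)
qed

lemma hessian_mult_vector:
  assumes "(gradient f has_derivative D) (at x)"
  shows "hessian f x *v k = D k"
proof -
  have "hessian f x = matrix D"
    unfolding hessian_def jacobian_def using frechet_derivative_at[OF assms] by simp
  then show ?thesis
    using matrix_works[of D] has_derivative_linear[OF assms] by (simp add: linear_matrix_vector_mul_eq)
qed

lemma inf_laplacian_radial_quartic:
  fixes z p :: "real^'n"
  defines "\<rho> \<equiv> (p - z) \<bullet> (p - z)"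
  shows "inf_laplacian (radial_quartic \<alpha> \<beta> z) p =
     32 * (\<alpha> + 2 * \<beta> * \<rho>)\<^sup>2 * \<beta> * \<rho>\<^sup>2 + 8 * (\<alpha> + 2 * \<beta> * \<rho>) ^ 3 * \<rho>"
proof -
  define A where "A = 2 * \<alpha> + 4 * \<beta> * \<rho>"
  have "inf_laplacian (radial_quartic \<alpha> \<beta> z) p
      = (A *\<^sub>R (A *\<^sub>R (p - z)) + (8 * \<beta> * ((p - z) \<bullet> (A *\<^sub>R (p - z)))) *\<^sub>R (p - z)) \<bullet> (A *\<^sub>R (p - z))"
    unfolding inf_laplacian_def hessian_mult_vector[OF gradient_radial_quartic_has_derivative]
    unfolding gradient_radial_quartic A_def \<rho>_def by simp
  also have "\<dots> = A ^ 3 * \<rho> + 8 * \<beta> * A\<^sup>2 * \<rho>\<^sup>2"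
    by (simp add: inner_add_left \<rho>_def power2_eq_square power3_eq_cube algebra_simps)
  also have "\<dots> = 32 * (\<alpha> + 2 * \<beta> * \<rho>)\<^sup>2 * \<beta> * \<rho>\<^sup>2 + 8 * (\<alpha> + 2 * \<beta> * \<rho>) ^ 3 * \<rho>"
  proof -
    have "A = 2 * (\<alpha> + 2 * \<beta> * \<rho>)" by (simp add: A_def)
    then show ?thesis by (simp add: power2_eq_square power3_eq_cube algebra_simps)
  qed
  finally show ?thesis .
qed

text \<open>Second order Taylor polynomial with an enlarged quadratic coefficient, as an upper bound. The
  second derivative is needed at the point \<open>t\<close> only.\<close>
lemma taylor2_upper:
  fixes H H1 :: "real \<Rightarrow> real"
  assumes H: "\<forall>\<^sub>F s in nhds t. (H has_real_derivative H1 s) (at s)"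
    and H1: "(H1 has_real_derivative H2) (at t)" and "b > H2"
  shows "\<forall>\<^sub>F s in nhds t. H s \<le> H t + H1 t * (s - t) + b / 2 * (s - t)\<^sup>2"
proof -
  define D where "D s = H s - H t - H1 t * (s - t) - b / 2 * (s - t)\<^sup>2" for s
  define D1 where "D1 s = H1 s - H1 t - b * (s - t)" for s
  have "(D1 has_real_derivative (H2 - b)) (at t)"
    unfolding D1_def by (auto intro!: derivative_eq_intros H1)
  from has_real_derivative_neg_dec_left[OF this] has_real_derivative_neg_dec_right[OF this] \<open>b > H2\<close>
  obtain d1 d2 where d: "d1 > 0" "\<And>k. 0 < k \<Longrightarrow> k < d1 \<Longrightarrow> D1 t < D1 (t - k)"
    "d2 > 0" "\<And>k. 0 < k \<Longrightarrow> k < d2 \<Longrightarrow> D1 (t + k) < D1 t" by auto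
  obtain d3 where d3: "d3 > 0" "\<And>s. \<bar>s - t\<bar> < d3 \<Longrightarrow> (H has_real_derivative H1 s) (at s)"
    using H by (auto simp: eventually_nhds_metric dist_real_def)
  have D1t: "D1 t = 0" "D t = 0" by (simp_all add: D1_def D_def)
  have deriv: "(D has_real_derivative D1 s) (at s)" if "\<bar>s - t\<bar> < d3" for s
    unfolding D_def D1_def by (auto intro!: derivative_eq_intros d3(2)[OF that] simp: field_simps)
  have "D s \<le> 0" if s: "\<bar>s - t\<bar> < Min {d1, d2, d3}" for s
  proof -
    consider "s = t" | "s < t" | "s > t" by linarith
    then show ?thesis
    proof cases
      case 2
      have "D s \<le> D t"
      proof (rule DERIV_nonneg_imp_nondecreasing[where f = D])
        show "s \<le> t" using 2 by simp
        fix x assume x: "s \<le> x" "x \<le> t"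
        have "D1 x \<ge> 0" using d(2)[of "t - x"] x s D1t by (cases "x = t") auto
        then show "\<exists>y. (D has_real_derivative y) (at x) \<and> 0 \<le> y"
          using deriv[of x] x s by auto
      qed
      then show ?thesis by (simp add: D1t)
    next
      case 3
      have "D s \<le> D t"
      proof (rule DERIV_nonpos_imp_nonincreasing[where f = D])
        show "t \<le> s" using 3 by simp
        fix x assume x: "t \<le> x" "x \<le> s"
        have "D1 x \<le> 0" using d(4)[of "x - t"] x s D1t by (cases "x = t") auto
        then show "\<exists>y. (D has_real_derivative y) (at x) \<and> y \<le> 0"
          using deriv[of x] x s by auto
      qed
      then show ?thesis by (simp add: D1t)
    qed (simp add: D1t)
  qed
  then have "\<forall>\<^sub>F s in nhds t. D s \<le> 0"
    unfolding eventually_nhds_metric dist_real_def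
    using d(1,3) d3(1) by (intro exI[of _ "Min {d1, d2, d3}"]) auto
  then show ?thesis by (rule eventually_mono) (simp add: D_def)
qed

section \<open>One-sided bounds for the infinity Laplacian in the viscosity sense\<close>

text \<open>The infinity Laplacian of \<open>u\<close> is at least the constant \<open>c\<close> on \<open>S\<close> in the viscosity sense.
  The test functions are required to be twice continuously differentiable on the whole space,
  so that those for a ball are also test functions for every larger domain.\<close>
definition inf_laplacian_ge :: "(real^'n) set \<Rightarrow> (real^'n \<Rightarrow> real) \<Rightarrow> real \<Rightarrow> bool" where
  "inf_laplacian_ge S u c \<longleftrightarrow>
     (\<forall>\<phi> p. C2_on UNIV \<phi> \<longrightarrow> local_max_at S (\<lambda>x. u x - \<phi> x) p \<longrightarrow> c \<le> inf_laplacian \<phi> p)"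

text \<open>A radial function \<open>G(\<bar>x - z\<bar>)\<close> may serve as test function away from its centre, although it
  need not be smooth on all of the space: as a function of the squared distance it is majorised
  near the contact point by its second Taylor polynomial with a slightly larger quadratic
  coefficient, which yields a radial quartic.\<close>
lemma inf_laplacian_ge_radial:
  fixes z p :: "real^'n" and G G1 :: "real \<Rightarrow> real"
  defines "r \<equiv> dist p z"
  assumes u: "inf_laplacian_ge S u c" and pz: "p \<noteq> z"
    and G: "\<forall>\<^sub>F s in nhds r. (G has_real_derivative G1 s) (at s)"
    and G1: "(G1 has_real_derivative G2) (at r)"
    and max: "local_max_at S (\<lambda>x. u x - G (dist x z)) p"
  shows "c \<le> (G1 r)\<^sup>2 * G2"
proof -
  have r: "r > 0" using pz by (simp add: r_def)
  define t where "t = r\<^sup>2"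
  have t: "t > 0" "sqrt t = r" using r by (simp_all add: t_def)
  define H where "H s = G (sqrt s)" for s
  define H1 where "H1 s = G1 (sqrt s) * (inverse (sqrt s) / 2)" for s
  define H2 where "H2 = (G2 - G1 r / r) / (4 * r\<^sup>2)"
  have "((\<lambda>s. sqrt s) \<longlongrightarrow> r) (nhds t)"
    using tendsto_real_sqrt[OF filterlim_ident, of t] t(2) by simp
  then have ev: "\<forall>\<^sub>F s in nhds t. (G has_real_derivative G1 (sqrt s)) (at (sqrt s))"
    by (rule eventually_compose_filterlim[OF G])
  have "\<forall>\<^sub>F s in nhds t. s > 0" using t(1) eventually_nhds_in_open[of "{0<..}" t] by simp
  with ev have H: "\<forall>\<^sub>F s in nhds t. (H has_real_derivative H1 s) (at s)"
  proof eventually_elim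
    case (elim s)
    show ?case unfolding H_def H1_def
      using DERIV_chain2[OF elim(1) DERIV_real_sqrt[OF elim(2)]] by simp
  qed
  have "((\<lambda>s. G1 (sqrt s)) has_real_derivative G2 * (inverse (sqrt t) / 2)) (at t)"
    by (rule DERIV_chain2[where f = G1]) (use G1 DERIV_real_sqrt[OF t(1)] t(2) in auto)
  then have "(H1 has_real_derivative
      G1 (sqrt t) * (- (inverse (sqrt t) * (inverse (sqrt t) / 2) * inverse (sqrt t)) / 2)
      + G2 * (inverse (sqrt t) / 2) * (inverse (sqrt t) / 2)) (at t)"
    unfolding H1_def
    by (intro DERIV_mult' DERIV_cdivide DERIV_inverse' DERIV_real_sqrt t(1)) (use t r in auto)
  also have "G1 (sqrt t) * (- (inverse (sqrt t) * (inverse (sqrt t) / 2) * inverse (sqrt t)) / 2)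
      + G2 * (inverse (sqrt t) / 2) * (inverse (sqrt t) / 2) = H2"
    unfolding t(2) H2_def using r by (simp add: inverse_eq_divide divide_simps power2_eq_square)
  finally have H1: "(H1 has_real_derivative H2) (at t)" .
  \<comment> \<open>\<open>F e\<close> is the infinity Laplacian at \<open>p\<close> of the quartic whose quadratic coefficient in the
      squared distance exceeds the Taylor coefficient by \<open>e\<close>.\<close>
  define F where "F e = (let B = H2 / 2 + e; A = H1 t - 2 * B * t in
       32 * (A + 2 * B * t)\<^sup>2 * B * t\<^sup>2 + 8 * (A + 2 * B * t) ^ 3 * t)" for e
  have tp: "(p - z) \<bullet> (p - z) = t" by (simp add: t_def r_def dist_norm power2_norm_eq_inner)
  have "c \<le> F e" if "e > 0" for e
  proof -
    define B where "B = H2 / 2 + e"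
    define A where "A = H1 t - 2 * B * t"
    define \<phi> where "\<phi> = radial_quartic A B z"
    have \<phi>: "\<phi> x = A * s + B * s\<^sup>2" if "s = (dist x z)\<^sup>2" for x s
      by (simp add: \<phi>_def radial_quartic_def that dist_norm power2_norm_eq_inner)
    have le: "\<forall>\<^sub>F s in nhds t. H s \<le> H t + H1 t * (s - t) + (2 * B) / 2 * (s - t)\<^sup>2"
      using that by (intro taylor2_upper[OF H H1]) (simp add: B_def)
    have "((\<lambda>x. (dist x z)\<^sup>2) \<longlongrightarrow> (dist p z)\<^sup>2) (nhds p)"
      by (intro tendsto_intros filterlim_ident)
    then have "filterlim (\<lambda>x. (dist x z)\<^sup>2) (nhds t) (nhds p)"
      by (simp add: t_def r_def)
    from eventually_compose_filterlim[OF le this]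
    have "\<forall>\<^sub>F x in nhds p. H ((dist x z)\<^sup>2)
        \<le> H t + H1 t * ((dist x z)\<^sup>2 - t) + (2 * B) / 2 * ((dist x z)\<^sup>2 - t)\<^sup>2" .
    then have "\<forall>\<^sub>F x in nhds p. G (dist x z) - G r \<le> \<phi> x - \<phi> p"
    proof eventually_elim
      case (elim x)
      have "\<phi> p = A * t + B * t\<^sup>2" by (rule \<phi>) (simp add: t_def r_def)
      with elim show ?case
        by (simp add: H_def t \<phi>[OF refl] A_def algebra_simps power2_eq_square)
    qed
    then obtain d1 where d1: "d1 > 0" "\<And>x. dist x p < d1 \<Longrightarrow> G (dist x z) - G r \<le> \<phi> x - \<phi> p"
      by (auto simp: eventually_nhds_metric)
    obtain d2 where d2: "d2 > 0" "p \<in> S"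
      "\<And>x. x \<in> S \<Longrightarrow> dist p x < d2 \<Longrightarrow> u x - G (dist x z) \<le> u p - G r"
      using max by (auto simp: local_max_at_def r_def)
    have "local_max_at S (\<lambda>x. u x - \<phi> x) p"
      unfolding local_max_at_def
    proof (intro conjI exI[of _ "min d1 d2"] ballI)
      fix x assume x: "x \<in> S \<inter> ball p (min d1 d2)"
      then show "u x - \<phi> x \<le> u p - \<phi> p"
        using d1(2)[of x] d2(3)[of x] by (auto simp: dist_commute)
    qed (use d1 d2 in auto)
    then have "c \<le> inf_laplacian \<phi> p"
      using u C2_on_radial_quartic by (auto simp: inf_laplacian_ge_def \<phi>_def)
    then show ?thesis
      by (simp add: \<phi>_def inf_laplacian_radial_quartic tp F_def Let_def A_def B_def)
  qed
  moreover have "(F \<longlongrightarrow> F 0) (at_right 0)"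
    unfolding F_def Let_def by (intro tendsto_intros)
  ultimately have "c \<le> F 0"
    by (intro tendsto_lowerbound[of F "F 0" "at_right 0"]) (auto simp: eventually_at_right_less eventually_at_filter)
  also have "F 0 = (G1 r)\<^sup>2 * G2"
  proof -
    define g where "g = G1 r / r"
    have gr: "G1 r = g * r" using r by (simp add: g_def)
    have H1t: "H1 t = g / 2" by (simp add: H1_def t(2) g_def inverse_eq_divide)
    have H2t: "H2 / 2 * t\<^sup>2 = (G2 - g) / 8 * r\<^sup>2"
      using r by (simp add: H2_def g_def[symmetric] t_def power2_eq_square)
    have "F 0 = 32 * (H1 t)\<^sup>2 * (H2 / 2 * t\<^sup>2) + 8 * (H1 t) ^ 3 * t"
      by (simp add: F_def Let_def)
    then have "F 0 = 32 * (g / 2)\<^sup>2 * ((G2 - g) / 8 * r\<^sup>2) + 8 * (g / 2) ^ 3 * t"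
      by (simp only: H1t H2t)
    then show ?thesis
      unfolding gr by (simp add: t_def field_simps power2_eq_square power3_eq_cube)
  qed
  finally show ?thesis .
qed

section \<open>Radial barriers\<close>

text \<open>The power \<open>t ^ (4/3)\<close> for \<open>t \<ge> 0\<close>, extended by zero; it is convex and continuously
  differentiable on the line.\<close>
definition profile :: "real \<Rightarrow> real" where
  "profile t = max t 0 powr (4/3)"

lemma profile_has_derivative:
  "(profile has_real_derivative (4/3) * max t 0 powr (1/3)) (at t)"
proof -
  consider "t > 0" | "t < 0" | "t = 0" by linarith
  then show ?thesis
  proof cases
    case 1
    have "((\<lambda>t. t powr (4/3)) has_real_derivative (4/3) * max t 0 powr (1/3)) (at t)"
      using has_real_derivative_powr[OF 1, of "4/3"] 1 by simp
    then show ?thesis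
      by (rule has_field_derivative_transform_within_open[of _ _ _ "{0<..}"])
        (use 1 in \<open>auto simp: profile_def\<close>)
  next
    case 2
    have "((\<lambda>t. 0) has_real_derivative (4/3) * max t 0 powr (1/3)) (at t)"
      using 2 by simp
    then show ?thesis
      by (rule has_field_derivative_transform_within_open[of _ _ _ "{..<0}"])
        (use 2 in \<open>auto simp: profile_def\<close>)
  next
    case 3
    have "profile s - profile 0 = max s 0 powr (1/3) * (s - 0)" for s
    proof (cases "s > 0")
      case True
      then have "s powr (1/3 + 1) = s powr (1/3) * s" by (simp only: powr_add powr_one)
      then show ?thesis using True by (simp add: profile_def)
    qed (simp add: profile_def)
    moreover have "isCont (\<lambda>s::real. max s 0 powr (1/3)) 0"
      unfolding isCont_def by (intro tendsto_intros tendsto_powr') auto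
    ultimately show ?thesis unfolding CARAT_DERIV 3 by (intro exI[of _ "\<lambda>s. max s 0 powr (1/3)"]) auto
  qed
qed

lemma continuous_on_profile: "continuous_on S profile"
  using profile_has_derivative by (meson DERIV_continuous_on has_field_derivative_at_within)

lemma continuous_on_profile_comp [continuous_intros]:
  "continuous_on S g \<Longrightarrow> continuous_on S (\<lambda>x. profile (g x))"
  using continuous_on_compose2[OF continuous_on_profile[of UNIV], of S g] by simp

lemma profile_mono: "s \<le> t \<Longrightarrow> profile s \<le> profile t"
  unfolding profile_def by (intro powr_mono2) auto

lemma profile_strict_mono: "0 \<le> s \<Longrightarrow> s < t \<Longrightarrow> profile s < profile t"
  unfolding profile_def by (intro powr_less_mono2) auto

lemma profile_nonpos: "t \<le> 0 \<Longrightarrow> profile t = 0"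
  by (simp add: profile_def)

text \<open>Convexity of the profile, stated for increments over steps of a fixed length.\<close>
lemma profile_increment_mono:
  assumes "l \<ge> 0" "s \<le> t"
  shows "profile s - profile (s - l) \<le> profile t - profile (t - l)"
proof (rule DERIV_nonneg_imp_nondecreasing[where f = "\<lambda>t. profile t - profile (t - l)", OF assms(2)])
  fix x
  have "((\<lambda>t. profile t - profile (t - l)) has_real_derivative
      ((4/3) * max x 0 powr (1/3) - (4/3) * max (x - l) 0 powr (1/3) * 1)) (at x)"
    by (intro DERIV_diff profile_has_derivative DERIV_chain2[of profile]) (auto intro!: derivative_eq_intros)
  moreover have "max (x - l) 0 powr (1/3) \<le> max x 0 powr (1/3)"
    using assms(1) by (intro powr_mono2) auto
  ultimately show "\<exists>y. ((\<lambda>t. profile t - profile (t - l)) has_real_derivative y) (at x) \<and> 0 \<le> y"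
    by (intro exI[of _ "(4/3) * max x 0 powr (1/3) - (4/3) * max (x - l) 0 powr (1/3) * 1"]) simp
qed

lemma profile_increment_surj:
  assumes "l > 0" "T \<ge> profile a0 - profile (a0 - l)"
  shows "\<exists>a\<ge>a0. profile a - profile (a - l) = T"
proof -
  \<comment> \<open>Any \<open>b\<close> with \<open>b - l \<ge> (T/l) ^ 3\<close> makes the increment at least \<open>l * (b - l) ^ (1/3) \<ge> T\<close>.\<close>
  define b where "b = \<bar>a0\<bar> + \<bar>T / l\<bar> ^ 3 + l"
  have b: "b - l \<ge> 0" "b \<ge> a0" "b - l \<ge> \<bar>T / l\<bar> ^ 3"
    using assms(1) zero_le_power[OF abs_ge_zero, of "T / l" 3] unfolding b_def by linarith+
  define s where "s = b - l"
  have s: "s \<ge> 0" "b = s + l" "s \<ge> \<bar>T / l\<bar> ^ 3" using b by (auto simp: s_def)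
  have root: "s powr (1/3) \<ge> \<bar>T / l\<bar>"
  proof -
    have "\<bar>T / l\<bar> = (\<bar>T / l\<bar> ^ 3) powr (1/3)"
      by (cases "T = 0") (use assms(1) in \<open>auto simp: powr_powr simp flip: powr_numeral\<close>)
    also have "\<dots> \<le> s powr (1/3)" using s by (intro powr_mono2) auto
    finally show ?thesis .
  qed
  have split: "r powr (4/3) = r * r powr (1/3)" if "r \<ge> 0" for r :: real
    using powr_add[of r 1 "1/3"] that by simp
  have "T \<le> l * s powr (1/3)"
    using root assms(1) by (simp add: field_simps abs_if split: if_splits)
  also have "\<dots> \<le> (s + l) * (s + l) powr (1/3) - s * s powr (1/3)"
  proof -
    have "s powr (1/3) \<le> (s + l) powr (1/3)" using s assms(1) by (intro powr_mono2) auto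
    then have "(s + l) * s powr (1/3) \<le> (s + l) * (s + l) powr (1/3)"
      using s assms(1) by (intro mult_left_mono) auto
    then show ?thesis by (simp add: algebra_simps)
  qed
  also have "\<dots> = profile b - profile (b - l)"
    using s assms(1) by (simp add: profile_def split)
  finally have "T \<le> profile b - profile (b - l)" .
  then have "\<exists>a. a0 \<le> a \<and> a \<le> b \<and> profile a - profile (a - l) = T"
    using assms b by (intro IVT') (auto intro!: continuous_intros)
  then show ?thesis by blast
qed

text \<open>The function \<open>G\<close> with \<open>G 0 = 0\<close> and \<open>G' r = (a + 3 c r) ^ (1/3)\<close>, the base being replaced by zero
  where it is negative, for \<open>c\<close> of either sign and different from zero. It satisfies
  \<open>G' ^ 2 * G'' = c\<close> where \<open>a + 3 c r > 0\<close>. When \<open>c < 0\<close> and \<open>a \<ge> 0\<close> it increases until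
  \<open>a + 3 c r\<close> vanishes and is constant from there on.\<close>
definition barrier :: "real \<Rightarrow> real \<Rightarrow> real \<Rightarrow> real" where
  "barrier c a r = (profile (a + 3 * c * r) - profile a) / (4 * c)"

lemma barrier_0 [simp]: "barrier c a 0 = 0"
  by (simp add: barrier_def)

lemma continuous_on_barrier [continuous_intros]:
  "c \<noteq> 0 \<Longrightarrow> continuous_on S g \<Longrightarrow> continuous_on S (\<lambda>x. barrier c a (g x))"
  unfolding barrier_def by (intro continuous_intros) auto

lemma barrier_mono: "r \<le> s \<Longrightarrow> barrier c a r \<le> barrier c a s"
proof -
  assume rs: "r \<le> s"
  consider "c > 0" | "c < 0" | "c = 0" by linarith
  then show ?thesis
  proof cases
    case 1
    then have "profile (a + 3 * c * r) \<le> profile (a + 3 * c * s)" using rs by (intro profile_mono) simp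
    then show ?thesis using 1 by (simp add: barrier_def divide_right_mono)
  next
    case 2
    then have "profile (a + 3 * c * r) \<ge> profile (a + 3 * c * s)" using rs by (intro profile_mono) simp
    then show ?thesis using 2 by (simp add: barrier_def divide_right_mono_neg)
  qed (simp add: barrier_def)
qed

lemma barrier_has_derivative:
  assumes "c \<noteq> 0"
  shows "(barrier c a has_real_derivative max (a + 3 * c * r) 0 powr (1/3)) (at r)"
proof -
  have "((\<lambda>r. profile (a + 3 * c * r)) has_real_derivative
      ((4/3) * max (a + 3 * c * r) 0 powr (1/3)) * (3 * c)) (at r)"
    by (rule DERIV_chain2[OF profile_has_derivative]) (auto intro!: derivative_eq_intros)
  then show ?thesis
    unfolding barrier_def[abs_def] using assms by (auto intro!: derivative_eq_intros)
qed

lemma barrier_has_second_derivative: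
  assumes "a + 3 * c * r > 0"
  shows "((\<lambda>r. max (a + 3 * c * r) 0 powr (1/3)) has_real_derivative
           c * (a + 3 * c * r) powr (-2/3)) (at r)"
proof -
  have "((\<lambda>r. (a + 3 * c * r) powr (1/3)) has_real_derivative
           ((1/3) * (a + 3 * c * r) powr (1/3 - 1)) * (3 * c)) (at r)"
    by (rule DERIV_chain2[where f = "\<lambda>t. t powr (1/3)" and g = "\<lambda>r. a + 3 * c * r"])
      (auto intro!: derivative_eq_intros has_real_derivative_powr assms)
  then have *: "((\<lambda>r. (a + 3 * c * r) powr (1/3)) has_real_derivative
           c * (a + 3 * c * r) powr (-2/3)) (at r)" by (simp add: mult.commute)
  have "open {r. a + 3 * c * r > 0}" by (intro open_Collect_less continuous_intros)
  then show ?thesis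
    by (rule has_field_derivative_transform_within_open[OF *]) (use assms in auto)
qed

text \<open>Away from its centre, where it is strictly increasing, a barrier with constant \<open>c\<close> can only
  touch \<open>u\<close> from above when the lower bound for the infinity Laplacian of \<open>u\<close> does not exceed \<open>c\<close>.\<close>
lemma inf_laplacian_ge_barrier:
  fixes z p :: "real^'n"
  assumes "inf_laplacian_ge S u c'" "p \<noteq> z" "c \<noteq> 0" "a + 3 * c * dist p z > 0"
    and "local_max_at S (\<lambda>x. u x - barrier c a (dist x z)) p"
  shows "c' \<le> c"
proof -
  define t where "t = a + 3 * c * dist p z"
  have "c' \<le> (max t 0 powr (1/3))\<^sup>2 * (c * t powr (-2/3))"
    unfolding t_def
    by (rule inf_laplacian_ge_radial[OF assms(1,2) _ barrier_has_second_derivative assms(5)])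
      (use assms in \<open>auto intro: always_eventually barrier_has_derivative\<close>)
  also have "(max t 0 powr (1/3))\<^sup>2 = t powr (2/3)"
    using assms(4) by (simp add: t_def powr_power)
  also have "t powr (2/3) * (c * t powr (-2/3)) = c"
    using assms(4) by (simp add: t_def powr_minus field_simps)
  finally show ?thesis .
qed

text \<open>Comparison with a barrier centred at \<open>z\<close>. The bound \<open>u z + barrier c a R\<close> is required on the whole
  ball and not only on the sphere, in order to cover the points where a barrier with \<open>c < 0\<close> is
  already constant. The conclusion is strict because equality would be a contact in the
  interior.\<close>
lemma barrier_comparison:
  fixes z x :: "real^'n"
  assumes u: "inf_laplacian_ge (ball z R) u c'" "continuous_on (cball z R) u"
    and c: "c < c'" "c \<noteq> 0" and a: "a \<ge> 0"
    and bd: "\<And>x. x \<in> cball z R \<Longrightarrow> u x \<le> u z + barrier c a R"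
    and x: "x \<noteq> z" "dist x z < R" "a + 3 * c * dist x z > 0"
  shows "u x < u z + barrier c a (dist x z)"
proof (rule ccontr)
  assume neg: "\<not> ?thesis"
  define W where "W x = u x - barrier c a (dist x z)" for x
  have "continuous_on (cball z R) W"
    unfolding W_def using u(2) c by (intro continuous_intros)
  then obtain p where p: "p \<in> cball z R" "\<And>y. y \<in> cball z R \<Longrightarrow> W y \<le> W p"
    using continuous_attains_sup[of "cball z R" W] le_less_trans[OF zero_le_dist x(2)] by auto
  have Wx: "W x \<ge> u z" using neg by (simp add: W_def)
  \<comment> \<open>A maximum point of \<open>W\<close> at which the barrier is a test function: \<open>x\<close> itself if \<open>x\<close> is
      one; otherwise the maximum exceeds \<open>u z\<close>, which excludes the centre, the sphere and the
      region where the barrier is constant.\<close>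
  obtain q where q: "q \<in> ball z R" "q \<noteq> z" "a + 3 * c * dist q z > 0"
    "\<And>y. y \<in> cball z R \<Longrightarrow> W y \<le> W q"
  proof (cases "W p = W x")
    case True
    then show ?thesis using that[of x] x p by (simp add: dist_commute)
  next
    case False
    then have Wp: "W p > u z" using Wx p(2)[of x] x by (simp add: dist_commute)
    have pz: "p \<noteq> z" using Wp by (auto simp: W_def)
    have pR: "dist p z < R"
      using Wp bd[OF p(1)] p(1) by (cases "dist p z = R") (auto simp: W_def dist_commute)
    have "a + 3 * c * dist p z > 0"
    proof (rule ccontr)
      assume np: "\<not> ?thesis"
      have "c < 0"
      proof (rule ccontr)
        assume "\<not> c < 0"
        then have "0 < c * dist p z" using c(2) pz by simp
        then show False using np a by linarith
      qed
      then have "3 * c * R \<le> 3 * c * dist p z" using pR by simp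
      then have "barrier c a R = barrier c a (dist p z)"
        using np by (simp add: barrier_def profile_nonpos)
      then show False using Wp bd[OF p(1)] by (simp add: W_def)
    qed
    then show ?thesis using that[of p] p pz pR by (simp add: dist_commute)
  qed
  have "local_max_at (ball z R) (\<lambda>x. u x - barrier c a (dist x z)) q"
    using q unfolding local_max_at_def W_def by (auto intro!: exI[of _ 1])
  then have "c' \<le> c" by (rule inf_laplacian_ge_barrier[OF u(1) q(2) c(2) q(3)])
  then show False using c by simp
qed

section \<open>Growth and increments on balls\<close>

lemma constant_if_4_3_Hoelder:
  fixes u :: "'a::real_normed_vector \<Rightarrow> real"
  assumes "open S" "convex S"
    and H: "\<And>x y. x \<in> S \<Longrightarrow> y \<in> S \<Longrightarrow> u x \<le> u y + C * dist x y powr (4/3)"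
    and xy: "x \<in> S" "y \<in> S"
  shows "u x = u y"
proof (rule has_derivative_zero_unique[OF assms(2) _ xy])
  fix x assume x: "x \<in> S"
  have "((\<lambda>y. \<bar>C\<bar> * dist y x powr (1/3)) \<longlongrightarrow> \<bar>C\<bar> * dist x x powr (1/3)) (at x within S)"
    by (intro tendsto_intros tendsto_powr') auto
  then have lim: "((\<lambda>y. \<bar>C\<bar> * dist y x powr (1/3)) \<longlongrightarrow> 0) (at x within S)" by simp
  have "((\<lambda>y. norm ((u y - u x) - 0) / norm (y - x)) \<longlongrightarrow> 0) (at x within S)"
  proof (rule Lim_null_comparison[OF _ lim])
    show "\<forall>\<^sub>F y in at x within S. norm (norm ((u y - u x) - 0) / norm (y - x)) \<le> \<bar>C\<bar> * dist y x powr (1/3)"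
      unfolding eventually_at_filter
    proof (intro always_eventually allI impI)
      fix y assume y: "y \<noteq> x" "y \<in> S"
      then have d: "dist y x > 0" by simp
      have "dist y x powr (4/3) = dist y x powr (1/3) * dist y x"
        using d powr_add[of "dist y x" "1/3" 1] by simp
      moreover have "\<bar>u y - u x\<bar> \<le> \<bar>C\<bar> * dist y x powr (4/3)"
        using H[OF y(2) x] H[OF x y(2)] mult_right_mono[of C "\<bar>C\<bar>" "dist y x powr (4/3)"]
        by (auto simp: dist_commute abs_if split: if_splits)
      ultimately show "norm (norm ((u y - u x) - 0) / norm (y - x)) \<le> \<bar>C\<bar> * dist y x powr (1/3)"
        using d by (simp add: dist_norm field_simps)
    qed
  qed
  then show "(u has_derivative (\<lambda>h. 0)) (at x within S)"
    by (simp add: has_derivative_iff_norm)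
qed

text \<open>If the infinity Laplacian of \<open>u\<close> exceeds \<open>c > 0\<close>, then \<open>u\<close> grows away from \<open>z\<close> at least like
  the barrier that starts with slope zero. That barrier is no test function at its vertex, where
  its second derivative is infinite. However, if the growth failed, then \<open>u\<close> would lie below such a
  barrier with vertex at any point near \<open>z\<close>, all contacts off the vertex being excluded; hence
  \<open>u\<close> would be Hoelder continuous with exponent \<open>4/3\<close> near \<open>z\<close>, so locally constant, with
  infinity Laplacian zero.\<close>
lemma growth_ge_barrier:
  fixes z :: "real^'n"
  assumes u: "inf_laplacian_ge (ball z R) u c'" "continuous_on (cball z R) u"
    and c: "c < c'" "0 < c" and R: "R > 0"
  shows "\<exists>x\<in>cball z R. u z + barrier c 0 R \<le> u x"
proof (rule ccontr)
  assume "\<not> ?thesis"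
  then have neg: "u x < u z + barrier c 0 R" if "x \<in> cball z R" for x using that by force
  obtain xm where xm: "xm \<in> cball z R" "\<And>y. y \<in> cball z R \<Longrightarrow> u y \<le> u xm"
    using continuous_attains_sup[of "cball z R" u] u(2) R by auto
  have c0: "c \<noteq> 0" using c by simp
  define g where "g y = u y + barrier c 0 (R - dist y z)" for y
  have "continuous_on (ball z R) g"
    unfolding g_def using u(2) by (intro continuous_intros c0 continuous_on_subset[OF u(2)]) auto
  then have "isCont g z"
    using R by (simp add: continuous_on_eq_continuous_at)
  then have "(g \<longlongrightarrow> g z) (nhds z)"
    by (simp add: isCont_def tendsto_at_iff_tendsto_nhds)
  moreover have "u xm < g z" using neg[OF xm(1)] by (simp add: g_def)
  ultimately have "\<forall>\<^sub>F y in nhds z. u xm < g y" by (rule order_tendstoD(1))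
  then
  obtain d0 where d0: "d0 > 0" "\<And>y. dist y z < d0 \<Longrightarrow> u xm < u y + barrier c 0 (R - dist y z)"
    by (auto simp: eventually_nhds_metric g_def)
  define d where "d = min d0 R"
  have d: "d > 0" "d \<le> R" "\<And>y. dist y z < d \<Longrightarrow> u xm < u y + barrier c 0 (R - dist y z)"
    using d0 R by (auto simp: d_def)
  have cone: "u x \<le> u y + barrier c 0 (dist x y)" if y: "y \<in> ball z d" and x: "x \<in> cball z R" for x y
  proof -
    define W where "W x = u x - barrier c 0 (dist x y)" for x
    have "continuous_on (cball z R) W"
      unfolding W_def by (intro continuous_intros c0 u(2))
    then obtain p where p: "p \<in> cball z R" "\<And>x. x \<in> cball z R \<Longrightarrow> W x \<le> W p"
      using continuous_attains_sup[of "cball z R" W] R by auto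
    have yz: "dist y z < d" using y by (simp add: dist_commute)
    have Wy: "W y \<le> W p" using p(2) y d(2) by auto
    have pR: "dist p z < R"
    proof (rule ccontr)
      assume "\<not> ?thesis"
      then have "R - dist y z \<le> dist p y" using dist_triangle[of p z y] by simp
      then have "barrier c 0 (R - dist y z) \<le> barrier c 0 (dist p y)" by (rule barrier_mono)
      then show False using d(3)[OF yz] xm(2)[OF p(1)] Wy by (simp add: W_def)
    qed
    have "p = y"
    proof (rule ccontr)
      assume py: "p \<noteq> y"
      have "local_max_at (ball z R) (\<lambda>x. u x - barrier c 0 (dist x y)) p"
        using p pR unfolding local_max_at_def W_def by (auto intro!: exI[of _ 1] simp: dist_commute)
      then have "c' \<le> c" using py c by (intro inf_laplacian_ge_barrier[OF u(1) py c0]) auto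
      then show False using c by simp
    qed
    then show ?thesis using p(2)[OF x] by (simp add: W_def)
  qed
  have const: "u x = u z" if "x \<in> ball z d" for x
  proof (rule constant_if_4_3_Hoelder[where S = "ball z d" and C = "(3 * c) powr (4/3) / (4 * c)"])
    fix x y assume xy: "x \<in> ball z d" "y \<in> ball z d"
    have "u x \<le> u y + barrier c 0 (dist x y)" using cone[of y x] xy d(2) by auto
    also have "barrier c 0 (dist x y) = (3 * c) powr (4/3) / (4 * c) * dist x y powr (4/3)"
      using c by (simp add: barrier_def profile_def powr_mult max_absorb1)
    finally show "u x \<le> u y + (3 * c) powr (4/3) / (4 * c) * dist x y powr (4/3)" .
  qed (use that d in auto)
  have rq: "radial_quartic 0 0 z x = 0" for x by (simp add: radial_quartic_def)
  have "local_max_at (ball z R) (\<lambda>x. u x - radial_quartic 0 0 z x) z"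
    unfolding local_max_at_def rq
  proof (intro conjI exI[of _ d] ballI)
    fix x assume "x \<in> ball z R \<inter> ball z d"
    then show "u x - 0 \<le> u z - 0" using const[of x] by simp
  qed (use R d in auto)
  then have "c' \<le> inf_laplacian (radial_quartic 0 0 z) z"
    using u(1) C2_on_radial_quartic by (auto simp: inf_laplacian_ge_def)
  then show False using c by (simp add: inf_laplacian_radial_quartic)
qed

text \<open>The parameter \<open>a\<close> is chosen such that the barrier takes at \<open>2 \<epsilon>\<close> the value \<open>u y2 - u z\<close>. Here and
  in the next lemma \<open>y\<close> need not be a maximum point.\<close>
lemma increments_pos:
  fixes z :: "real^'n"
  assumes u: "inf_laplacian_ge (ball z (2 * \<epsilon>)) u c'" "continuous_on (cball z (2 * \<epsilon>)) u"
    and c: "c < c'" "0 < c" and e: "\<epsilon> > 0"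
    and y: "y \<in> cball z \<epsilon>"
    and y2: "\<And>x. x \<in> cball z (2 * \<epsilon>) \<Longrightarrow> u x \<le> u y2"
  shows "\<exists>a. u y - u z < barrier c a \<epsilon> \<and> barrier c a (2 * \<epsilon>) - barrier c a \<epsilon> < u y2 - u y"
proof -
  have c0: "c \<noteq> 0" using c by simp
  obtain x where x: "x \<in> cball z (2 * \<epsilon>)" "u z + barrier c 0 (2 * \<epsilon>) \<le> u x"
    using growth_ge_barrier[OF u c] e by auto
  have "u y2 - u z \<ge> barrier c 0 (2 * \<epsilon>)" using y2[OF x(1)] x(2) by simp
  then have "4 * c * (u y2 - u z) \<ge> profile (6 * c * \<epsilon>) - profile (6 * c * \<epsilon> - 6 * c * \<epsilon>)"
    using c by (simp add: barrier_def field_simps profile_nonpos)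
  then obtain b where b: "b \<ge> 6 * c * \<epsilon>" "profile b - profile (b - 6 * c * \<epsilon>) = 4 * c * (u y2 - u z)"
    using profile_increment_surj[of "6 * c * \<epsilon>"] c e by fastforce
  \<comment> \<open>\<open>barrier c a (2 * \<epsilon>)\<close> is an increment of the profile over the step \<open>6 c \<epsilon>\<close>, ending at \<open>b\<close>.\<close>
  define a where "a = b - 6 * c * \<epsilon>"
  have a: "a \<ge> 0" using b by (simp add: a_def)
  have bR: "barrier c a (2 * \<epsilon>) = u y2 - u z"
    using b(2) c by (simp add: barrier_def a_def)
  have "u y < u z + barrier c a \<epsilon>"
  proof (cases "y = z")
    case True
    have "profile a < profile (a + 3 * c * \<epsilon>)" using a c e by (intro profile_strict_mono) auto
    then show ?thesis using True c by (simp add: barrier_def)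
  next
    case False
    have "u y < u z + barrier c a (dist y z)"
      using y e bR y2 a c False
      by (intro barrier_comparison[OF u c(1) c0 a]) (auto simp: dist_commute intro: add_nonneg_pos)
    also have "barrier c a (dist y z) \<le> barrier c a \<epsilon>"
      using y by (intro barrier_mono) (simp add: dist_commute)
    finally show ?thesis by simp
  qed
  then show ?thesis using bR by (intro exI[of _ a]) simp
qed

text \<open>For a negative constant no growth is needed. The inequalities are weak, since \<open>y\<close> may lie where
  the barrier is constant.\<close>
lemma increments_neg:
  fixes z :: "real^'n"
  assumes u: "inf_laplacian_ge (ball z (2 * \<epsilon>)) u c'" "continuous_on (cball z (2 * \<epsilon>)) u"
    and c: "c < c'" "c < 0" and e: "\<epsilon> > 0"
    and y: "y \<in> cball z \<epsilon>"
    and y2: "\<And>x. x \<in> cball z (2 * \<epsilon>) \<Longrightarrow> u x \<le> u y2"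
  shows "\<exists>a. u y - u z \<le> barrier c a \<epsilon> \<and> barrier c a (2 * \<epsilon>) - barrier c a \<epsilon> \<le> u y2 - u y"
proof -
  have c0: "c \<noteq> 0" using c by simp
  have "u z \<le> u y2" using y2 e by simp
  then have "- 4 * c * (u y2 - u z) \<ge> profile 0 - profile (0 - (- 6 * c * \<epsilon>))"
    using c e by (auto simp: profile_nonpos mult_nonpos_nonneg)
  then obtain a where a: "a \<ge> 0" "profile a - profile (a - (- 6 * c * \<epsilon>)) = - 4 * c * (u y2 - u z)"
    using profile_increment_surj[of "- 6 * c * \<epsilon>" 0] c e by (auto simp: mult_neg_pos)
  have bR: "barrier c a (2 * \<epsilon>) = u y2 - u z"
    using a(2) c by (simp add: barrier_def field_simps)
  have "u y \<le> u z + barrier c a \<epsilon>"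
  proof (cases "y = z")
    case True
    then show ?thesis using barrier_mono[of 0 \<epsilon> c a] e by simp
  next
    case False
    have "u y \<le> u z + barrier c a (dist y z)"
    proof (cases "a + 3 * c * dist y z > 0")
      case True
      then have "u y < u z + barrier c a (dist y z)"
        using y e bR y2 False
        by (intro barrier_comparison[OF u c(1) c0 a(1)]) (auto simp: dist_commute)
      then show ?thesis by simp
    next
      case np: False
      have "c * (2 * \<epsilon>) \<le> c * dist y z"
        using y c e by (intro mult_left_mono_neg) (auto simp: dist_commute)
      then have "barrier c a (2 * \<epsilon>) = barrier c a (dist y z)"
        using np by (simp add: barrier_def profile_nonpos)
      then show ?thesis using y2[of y] y e bR by auto
    qed
    also have "barrier c a (dist y z) \<le> barrier c a \<epsilon>"
      using y by (intro barrier_mono) (simp add: dist_commute)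
    finally show ?thesis by simp
  qed
  then show ?thesis using bR by (intro exI[of _ a]) simp
qed

text \<open>The increments of \<open>u\<close> and \<open>w\<close> cannot dominate each other crosswise. Up to the
  factor \<open>1 / (4 c)\<close> all the bounds are values of \<open>D t\<close>, the increment of the profile over a step \<open>l = 3 c \<epsilon>\<close> ending at \<open>t\<close>. The hypotheses give
  \<open>D (a + 2 l) < D b\<close> and \<open>D (b - l) < D (a + l)\<close>, and as \<open>D\<close> is monotone these require both
  \<open>b > a + 2 l\<close> and \<open>b < a + 2 l\<close>.\<close>
lemma increments_not_dominated:
  fixes z :: "real^'n"
  assumes u: "inf_laplacian_ge (ball z (2 * \<epsilon>)) u c1" "continuous_on (cball z (2 * \<epsilon>)) u"
    and w: "inf_laplacian_ge (ball z (2 * \<epsilon>)) w c2" "continuous_on (cball z (2 * \<epsilon>)) w"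
    and c: "c < c1" "- c < c2" "0 < c" and e: "\<epsilon> > 0"
    and y: "y \<in> cball z \<epsilon>" and y2: "\<And>x. x \<in> cball z (2 * \<epsilon>) \<Longrightarrow> u x \<le> u y2"
    and q: "q \<in> cball z \<epsilon>" and q2: "\<And>x. x \<in> cball z (2 * \<epsilon>) \<Longrightarrow> w x \<le> w q2"
    and le: "u y2 - u y \<le> w q - w z" "w q2 - w q \<le> u y - u z"
  shows False
proof -
  obtain a where a: "u y - u z < barrier c a \<epsilon>"
    "barrier c a (2 * \<epsilon>) - barrier c a \<epsilon> < u y2 - u y"
    using increments_pos[OF u c(1,3) e y y2] by blast
  obtain b where b: "w q - w z \<le> barrier (- c) b \<epsilon>"
    "barrier (- c) b (2 * \<epsilon>) - barrier (- c) b \<epsilon> \<le> w q2 - w q"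
    using increments_neg[OF w c(2) _ e q q2] c by auto
  define l where "l = 3 * c * \<epsilon>"
  have l: "l > 0" using c e by (simp add: l_def)
  define D where "D t = profile t - profile (t - l)" for t
  have D: "D s \<le> D t" if "s \<le> t" for s t
    unfolding D_def using profile_increment_mono[of l s t] l that by simp
  have B: "barrier c a \<epsilon> = D (a + l) / (4 * c)"
    "barrier c a (2 * \<epsilon>) - barrier c a \<epsilon> = D (a + 2 * l) / (4 * c)"
    "barrier (- c) b \<epsilon> = D b / (4 * c)"
    "barrier (- c) b (2 * \<epsilon>) - barrier (- c) b \<epsilon> = D (b - l) / (4 * c)"
    using c(3) by (simp_all add: barrier_def D_def l_def field_simps)
  have "D (a + 2 * l) / (4 * c) < D b / (4 * c)" "D (b - l) / (4 * c) < D (a + l) / (4 * c)"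
    using a b le B by linarith+
  then have "D (a + 2 * l) < D b" "D (b - l) < D (a + l)"
    using c(3) by (simp_all add: divide_less_cancel)
  then have "a + 2 * l < b" "b - l < a + l" using D by (meson not_le)+
  then show False by simp
qed

section \<open>Subsolutions and supersolutions\<close>

lemma inf_laplacian_ge_if_subsolution:
  assumes sub: "viscosity_subsolution \<Omega> lam m h u" and B: "open B" "B \<subseteq> \<Omega>"
    and c: "\<And>x. x \<in> B \<Longrightarrow> c \<le> lam x * max (u x) 0 powr m + h x"
  shows "inf_laplacian_ge B u c"
  unfolding inf_laplacian_ge_def
proof (intro allI impI)
  fix \<phi> p assume \<phi>: "C2_on UNIV \<phi>" "local_max_at B (\<lambda>x. u x - \<phi> x) p"
  have "C2_on \<Omega> \<phi>" using \<phi>(1) by (auto simp: C2_on_def intro: continuous_on_subset)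
  moreover have "local_max_at \<Omega> (\<lambda>x. u x - \<phi> x) p"
  proof -
    obtain r s where rs: "r > 0" "\<forall>x\<in>B \<inter> ball p r. u x - \<phi> x \<le> u p - \<phi> p"
      "s > 0" "ball p s \<subseteq> B" "p \<in> B"
      using \<phi>(2) B(1) unfolding local_max_at_def by (meson openE)
    then show ?thesis unfolding local_max_at_def using B
      by (intro conjI exI[of _ "min r s"]) (auto simp: subset_iff)
  qed
  ultimately have "lam p * max (u p) 0 powr m + h p \<le> inf_laplacian \<phi> p"
    using sub by (auto simp: viscosity_subsolution_def)
  moreover have "p \<in> B" using \<phi>(2) by (auto simp: local_max_at_def)
  ultimately show "c \<le> inf_laplacian \<phi> p" using c by force
qed

lemma gradient_uminus:
  assumes "f differentiable at x"
  shows "gradient (\<lambda>x. - f x) x = - gradient f x"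
proof -
  have "((\<lambda>x. - f x) has_derivative (\<lambda>k. - frechet_derivative f (at x) k)) (at x)"
    using assms frechet_derivative_works by (intro has_derivative_minus) blast
  from frechet_derivative_at[OF this, symmetric] show ?thesis
    by (simp add: gradient_def vec_eq_iff)
qed

lemma hessian_uminus:
  assumes "C2_on UNIV f"
  shows "hessian (\<lambda>x. - f x) x = - hessian f x"
proof -
  have g: "gradient (\<lambda>x. - f x) = (\<lambda>x. - gradient f x)"
    using assms by (auto simp: C2_on_def gradient_uminus)
  have "((\<lambda>x. - gradient f x) has_derivative (\<lambda>k. - frechet_derivative (gradient f) (at x) k)) (at x)"
    using assms frechet_derivative_works unfolding C2_on_def
    by (intro has_derivative_minus) blast
  from frechet_derivative_at[OF this, symmetric] show ?thesis
    by (simp add: hessian_def jacobian_def g matrix_def vec_eq_iff)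
qed

lemma C2_on_uminus:
  assumes "C2_on UNIV f"
  shows "C2_on UNIV (\<lambda>x. - f x)"
proof -
  have g: "gradient (\<lambda>x. - f x) = (\<lambda>x. - gradient f x)"
    using assms by (auto simp: C2_on_def gradient_uminus)
  show ?thesis
    using assms unfolding C2_on_def g hessian_uminus[OF assms, abs_def]
    by (auto intro: continuous_intros)
qed

lemma inf_laplacian_uminus:
  fixes f :: "real^'n \<Rightarrow> real"
  assumes "C2_on UNIV f"
  shows "inf_laplacian (\<lambda>x. - f x) x = - inf_laplacian f x"
proof -
  have "(- A) *v (- k) = A *v k" for A :: "real^'n^'n" and k
    by (simp add: matrix_vector_mult_def vec_eq_iff)
  then show ?thesis
    using assms by (simp add: inf_laplacian_def hessian_uminus gradient_uminus C2_on_def)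
qed

lemma inf_laplacian_ge_if_supersolution:
  assumes super: "viscosity_supersolution \<Omega> lam m h v" and B: "open B" "B \<subseteq> \<Omega>"
    and c: "\<And>x. x \<in> B \<Longrightarrow> lam x * max (v x) 0 powr m + h x \<le> c"
  shows "inf_laplacian_ge B (\<lambda>x. - v x) (- c)"
  unfolding inf_laplacian_ge_def
proof (intro allI impI)
  fix \<phi> p assume \<phi>: "C2_on UNIV \<phi>" "local_max_at B (\<lambda>x. - v x - \<phi> x) p"
  have "C2_on \<Omega> (\<lambda>x. - \<phi> x)"
    using C2_on_uminus[OF \<phi>(1)] by (auto simp: C2_on_def intro: continuous_on_subset)
  moreover have "local_min_at \<Omega> (\<lambda>x. v x - - \<phi> x) p"
  proof -
    obtain r s where rs: "r > 0" "\<forall>x\<in>B \<inter> ball p r. - v x - \<phi> x \<le> - v p - \<phi> p"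
      "s > 0" "ball p s \<subseteq> B" "p \<in> B"
      using \<phi>(2) B(1) unfolding local_max_at_def by (meson openE)
    have "v p - - \<phi> p \<le> v x - - \<phi> x" if "x \<in> ball p (min r s)" for x
    proof -
      have "x \<in> B \<inter> ball p r" using rs(4) that by auto
      then have "- v x - \<phi> x \<le> - v p - \<phi> p" using rs(2) by blast
      then show ?thesis by simp
    qed
    then show ?thesis unfolding local_min_at_def using B rs
      by (intro conjI exI[of _ "min r s"]) auto
  qed
  ultimately have "inf_laplacian (\<lambda>x. - \<phi> x) p \<le> lam p * max (v p) 0 powr m + h p"
    using super by (auto simp: viscosity_supersolution_def)
  moreover have "p \<in> B" using \<phi>(2) by (auto simp: local_max_at_def)
  ultimately show "- c \<le> inf_laplacian \<phi> p"
    using c[of p] inf_laplacian_uminus[OF \<phi>(1), of p] by linarith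
qed

lemma midpoint_in_cball:
  fixes x y :: "'a::real_normed_vector"
  assumes "dist y x \<le> 2 * \<epsilon>"
  obtains p where "dist p x \<le> \<epsilon>" "dist y p \<le> \<epsilon>"
  using assms that[of "midpoint x y"] dist_midpoint[of x y] by (auto simp: dist_commute)

section \<open>The comparison principle\<close>

text \<open>The triple \<open>(x0, y0, q0)\<close> maximises \<open>u y + w q\<close> among the triples \<open>(x, y, q)\<close> with \<open>x\<close> near \<open>x0\<close>
  and \<open>y\<close>, \<open>q\<close> within distance \<open>\<epsilon>\<close> of \<open>x\<close>. Moving \<open>x\<close> halfway to a point at distance at most
  \<open>2 \<epsilon>\<close> from \<open>x0\<close> makes both that point and \<open>x0\<close> admissible for \<open>y\<close> and \<open>q\<close>.\<close>
lemma enveloped_difference_max: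
  fixes u w :: "'a::{real_normed_vector,heine_borel} \<Rightarrow> real"
  assumes "continuous_on (cball x0 (2 * \<epsilon>)) u" "continuous_on (cball x0 (2 * \<epsilon>)) w" "\<epsilon> > 0"
    and "y0 \<in> cball x0 \<epsilon>" "q0 \<in> cball x0 \<epsilon>"
    and max: "\<And>x y q. dist x x0 \<le> \<epsilon> \<Longrightarrow> dist y x \<le> \<epsilon> \<Longrightarrow> dist q x \<le> \<epsilon> \<Longrightarrow> u y + w q \<le> u y0 + w q0"
  obtains y2 q2 where
    "\<And>x. x \<in> cball x0 (2 * \<epsilon>) \<Longrightarrow> u x \<le> u y2" "\<And>x. x \<in> cball x0 (2 * \<epsilon>) \<Longrightarrow> w x \<le> w q2"
    "u y2 - u y0 \<le> w q0 - w x0" "w q2 - w q0 \<le> u y0 - u x0"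
proof -
  obtain y2 where y2: "y2 \<in> cball x0 (2 * \<epsilon>)" "\<And>x. x \<in> cball x0 (2 * \<epsilon>) \<Longrightarrow> u x \<le> u y2"
    using continuous_attains_sup[of "cball x0 (2 * \<epsilon>)" u] assms by auto
  obtain q2 where q2: "q2 \<in> cball x0 (2 * \<epsilon>)" "\<And>x. x \<in> cball x0 (2 * \<epsilon>) \<Longrightarrow> w x \<le> w q2"
    using continuous_attains_sup[of "cball x0 (2 * \<epsilon>)" w] assms by auto
  obtain p where p: "dist p x0 \<le> \<epsilon>" "dist y2 p \<le> \<epsilon>"
    using midpoint_in_cball[of y2 x0 \<epsilon>] y2(1) by (auto simp: dist_commute)
  obtain p' where p': "dist p' x0 \<le> \<epsilon>" "dist q2 p' \<le> \<epsilon>"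
    using midpoint_in_cball[of q2 x0 \<epsilon>] q2(1) by (auto simp: dist_commute)
  have "u y2 + w x0 \<le> u y0 + w q0" "u x0 + w q2 \<le> u y0 + w q0"
    using max[of p y2 x0] max[of p' x0 q2] p p' by (auto simp: dist_commute)
  with y2 q2 show ?thesis by (intro that[of y2 q2]) auto
qed

theorem theorem1p1:
  fixes \<Omega> :: "(real^'n) set"
    and h lam u v :: "real^'n \<Rightarrow> real"
    and m :: real
  assumes "CARD('n) \<ge> 2"
    and "open \<Omega>" and "connected \<Omega>" and "\<Omega> \<noteq> {}" and "bounded \<Omega>"
    and "continuous_on \<Omega> h" and "\<exists>C. AE x in lebesgue_on \<Omega>. \<bar>h x\<bar> \<le> C"
    and "\<forall>x\<in>\<Omega>. h x \<le> 0"
    and "continuous_on \<Omega> lam" and "\<forall>x\<in>\<Omega>. lam x \<ge> 0"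
    and "0 < m" and "m < 3"
    and "continuous_on (closure \<Omega>) u" and "\<forall>x\<in>closure \<Omega>. u x \<ge> 0"
    and "continuous_on (closure \<Omega>) v" and "\<forall>x\<in>closure \<Omega>. v x \<ge> 0"
    and "viscosity_subsolution \<Omega> lam m h u"
    and "viscosity_supersolution \<Omega> lam m h v"
    and "\<forall>x \<in> frontier \<Omega> \<union> {x\<in>\<Omega>. lam x = 0}. u x \<le> v x"
  shows "\<forall>x\<in>\<Omega>. u x \<le> v x"
proof (rule ccontr)
  assume "\<not> ?thesis"
  then obtain x1 where x1: "x1 \<in> \<Omega>" "u x1 > v x1" by force
  note contu = \<open>continuous_on (closure \<Omega>) u\<close> and contv = \<open>continuous_on (closure \<Omega>) v\<close>
  have comp: "compact (closure \<Omega>)" using \<open>bounded \<Omega>\<close> by simp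
  have sub: "\<Omega> \<subseteq> closure \<Omega>" by (rule closure_subset)
  have contuv: "continuous_on (closure \<Omega>) (\<lambda>x. u x - v x)"
    by (intro continuous_intros contu contv)
  then obtain xm where xm: "xm \<in> closure \<Omega>" "\<And>x. x \<in> closure \<Omega> \<Longrightarrow> u x - v x \<le> u xm - v xm"
    using continuous_attains_sup[OF comp _ contuv] x1 sub by auto
  define \<theta> where "\<theta> = u xm - v xm"
  have \<theta>: "\<theta> > 0" using xm(2)[of x1] x1 sub by (auto simp: \<theta>_def)
  \<comment> \<open>\<open>N\<close> is where \<open>u - v\<close> is at least half of its maximum; it will contain the point \<open>x0\<close>.\<close>
  define N where "N = {x \<in> closure \<Omega>. \<theta> / 2 \<le> u x - v x}"
  have "closed N"
    unfolding N_def by (intro continuous_on_closed_Collect_le contuv) auto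
  moreover have "bounded N"
    by (rule bounded_subset[OF compact_imp_bounded[OF comp]]) (auto simp: N_def)
  ultimately have compN: "compact N" by (simp add: compact_eq_bounded_closed)
  have xmN: "xm \<in> N" using xm \<theta> by (simp add: N_def \<theta>_def)
  have N\<Omega>: "N \<subseteq> \<Omega>"
  proof
    fix x assume x: "x \<in> N"
    then have "x \<notin> frontier \<Omega>" using assms(19) \<theta> by (force simp: N_def)
    then show "x \<in> \<Omega>" using x \<open>open \<Omega>\<close> by (auto simp: N_def frontier_def interior_open)
  qed
  obtain \<rho> where \<rho>: "\<rho> > 0" "(\<Union>x\<in>N. cball x \<rho>) \<subseteq> \<Omega>"
    using compact_subset_open_imp_cball_epsilon_subset[OF compN \<open>open \<Omega>\<close> N\<Omega>] by blast
  define K where "K r = {x. infdist x N \<le> r}" for r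
  have compK: "compact (K r)" if "r > 0" for r
    unfolding K_def using compact_infdist_le[OF _ compN that] xmN by blast
  have K\<Omega>: "K \<rho> \<subseteq> \<Omega>"
  proof
    fix x assume x: "x \<in> K \<rho>"
    obtain n where "n \<in> N" "infdist x N = dist x n"
      using infdist_attains_inf[OF compact_imp_closed[OF compN], of x] xmN by blast
    then have "x \<in> cball n \<rho>" using x by (simp add: K_def dist_commute)
    then show "x \<in> \<Omega>" using \<rho>(2) \<open>n \<in> N\<close> by blast
  qed
  define gu where "gu x = lam x * max (u x) 0 powr m + h x" for x
  define gv where "gv x = lam x * max (v x) 0 powr m + h x" for x
  have contpow: "continuous_on \<Omega> (\<lambda>x. max (f x) 0 powr m)"
    if "continuous_on (closure \<Omega>) f" for f :: "real^'n \<Rightarrow> real"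
    using \<open>0 < m\<close> by (intro continuous_on_powr' continuous_on_max continuous_on_const
        continuous_on_subset[OF that sub]) auto
  have contg: "continuous_on \<Omega> gu" "continuous_on \<Omega> gv"
    unfolding gu_def gv_def
    by (intro continuous_on_add continuous_on_mult assms(6,9) contpow contu contv)+
  have "continuous_on N (\<lambda>x. gu x - gv x)"
    by (intro continuous_on_diff continuous_on_subset[OF contg(1) N\<Omega>]
        continuous_on_subset[OF contg(2) N\<Omega>])
  then obtain xn where xn: "xn \<in> N" "\<And>x. x \<in> N \<Longrightarrow> gu xn - gv xn \<le> gu x - gv x"
    using continuous_attains_inf[OF compN, of "\<lambda>x. gu x - gv x"] xmN by blast
  \<comment> \<open>\<open>\<eta>\<close> is the least gap on \<open>N\<close> between the right-hand sides for \<open>u\<close> and \<open>v\<close>.\<close>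
  define \<eta> where "\<eta> = gu xn - gv xn"
  have \<eta>: "\<eta> > 0"
  proof -
    have uv: "u xn > v xn" "v xn \<ge> 0" "xn \<in> \<Omega>"
      using xn(1) \<theta> N\<Omega> assms(16) by (auto simp: N_def)
    then have "lam xn > 0" using assms(10,19) by force
    moreover have "max (v xn) 0 powr m < max (u xn) 0 powr m"
      using uv \<open>0 < m\<close> by (intro powr_less_mono2) auto
    ultimately show ?thesis by (simp add: \<eta>_def gu_def gv_def)
  qed
  have unif: "\<exists>d>0. \<forall>x\<in>S. \<forall>y\<in>S. dist y x < d \<longrightarrow> \<bar>f y - f x\<bar> < e"
    if "compact S" "continuous_on S f" "e > 0" for S e and f :: "real^'n \<Rightarrow> real"
    using compact_uniformly_continuous[OF that(2,1)] that(3)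
    unfolding uniformly_continuous_on_def by (metis dist_real_def)
  note contgK = contg[THEN continuous_on_subset, OF K\<Omega>]
  note contK = contu[THEN continuous_on_subset, OF order_trans[OF K\<Omega> sub]]
    contv[THEN continuous_on_subset, OF order_trans[OF K\<Omega> sub]]
  have pos: "\<theta> / 4 > 0" "\<eta> / 4 > 0" using \<theta> \<eta> by simp_all
  obtain d1 where d1: "d1 > 0"
    "\<And>x y. x \<in> K \<rho> \<Longrightarrow> y \<in> K \<rho> \<Longrightarrow> dist y x < d1 \<Longrightarrow> \<bar>u y - u x\<bar> < \<theta> / 4"
    using unif[OF compK[OF \<rho>(1)] contK(1) pos(1)] by blast
  obtain d2 where d2: "d2 > 0"
    "\<And>x y. x \<in> K \<rho> \<Longrightarrow> y \<in> K \<rho> \<Longrightarrow> dist y x < d2 \<Longrightarrow> \<bar>v y - v x\<bar> < \<theta> / 4"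
    using unif[OF compK[OF \<rho>(1)] contK(2) pos(1)] by blast
  obtain d3 where d3: "d3 > 0"
    "\<And>x y. x \<in> K \<rho> \<Longrightarrow> y \<in> K \<rho> \<Longrightarrow> dist y x < d3 \<Longrightarrow> \<bar>gu y - gu x\<bar> < \<eta> / 4"
    using unif[OF compK[OF \<rho>(1)] contgK(1) pos(2)] by blast
  obtain d4 where d4: "d4 > 0"
    "\<And>x y. x \<in> K \<rho> \<Longrightarrow> y \<in> K \<rho> \<Longrightarrow> dist y x < d4 \<Longrightarrow> \<bar>gv y - gv x\<bar> < \<eta> / 4"
    using unif[OF compK[OF \<rho>(1)] contgK(2) pos(2)] by blast
  define \<epsilon> where "\<epsilon> = Min {\<rho>, d1, d2, d3, d4} / 3"
  have \<epsilon>: "\<epsilon> > 0" "2 * \<epsilon> < d1" "2 * \<epsilon> < d2" "2 * \<epsilon> < d3" "2 * \<epsilon> < d4" "2 * \<epsilon> \<le> \<rho>"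
    using \<rho>(1) d1(1) d2(1) d3(1) d4(1) by (auto simp: \<epsilon>_def min_def)
  have Kadd: "y \<in> K (r + s)" if "x \<in> K r" "dist y x \<le> s" for x y r s
    using that infdist_triangle[of y N x] by (simp add: K_def)
  \<comment> \<open>Maximising over triples replaces a maximum of \<open>u\<^sup>\<epsilon> - v\<^sub>\<epsilon>\<close> and spares the continuity of the
      envelopes. The base points range over the \<open>\<epsilon>\<close>-neighbourhood of \<open>N\<close> only; that \<open>x0\<close>
      turns out to lie in \<open>N\<close> makes it an interior point of this set.\<close>
  define P where "P = {(x, y, q). x \<in> K \<epsilon> \<and> y \<in> K \<rho> \<and> q \<in> K \<rho> \<and> dist y x \<le> \<epsilon> \<and> dist q x \<le> \<epsilon>}"
  have "P = (K \<epsilon> \<times> K \<rho> \<times> K \<rho>) \<inter> {t. dist (fst (snd t)) (fst t) \<le> \<epsilon> \<and> dist (snd (snd t)) (fst t) \<le> \<epsilon>}"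
    by (auto simp: P_def)
  moreover have "closed {t :: (real^'n) \<times> (real^'n) \<times> (real^'n).
      dist (fst (snd t)) (fst t) \<le> \<epsilon> \<and> dist (snd (snd t)) (fst t) \<le> \<epsilon>}"
    by (intro closed_Collect_conj closed_Collect_le continuous_intros)
  ultimately have compP: "compact P"
    using compK \<epsilon>(1) \<rho>(1) by (auto intro!: compact_Int_closed compact_Times)
  have K0: "n \<in> K r" if "n \<in> N" "r \<ge> 0" for n r using that by (simp add: K_def)
  have xmP: "(xm, xm, xm) \<in> P" using K0[OF xmN] \<epsilon>(1) \<rho>(1) by (simp add: P_def)
  have "continuous_on P (\<lambda>t. u (fst (snd t)) - v (snd (snd t)))"
    by (intro continuous_intros continuous_on_compose2[OF contK(1)] continuous_on_compose2[OF contK(2)])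
      (auto simp: P_def)
  then obtain t where t: "t \<in> P"
    "\<And>s. s \<in> P \<Longrightarrow> u (fst (snd s)) - v (snd (snd s)) \<le> u (fst (snd t)) - v (snd (snd t))"
    using continuous_attains_sup[OF compP] xmP by blast
  obtain x0 y0 q0 where t_eq: "t = (x0, y0, q0)" by (cases t) auto
  have P0: "x0 \<in> K \<epsilon>" "y0 \<in> K \<rho>" "q0 \<in> K \<rho>" "dist y0 x0 \<le> \<epsilon>" "dist q0 x0 \<le> \<epsilon>"
    using t(1) by (auto simp: t_eq P_def)
  have max: "u y - v q \<le> u y0 - v q0" if "(x, y, q) \<in> P" for x y q
    using t(2)[OF that] by (simp add: t_eq)
  have x0N: "x0 \<in> N"
  proof -
    have x0: "x0 \<in> K \<rho>" using P0(1) \<epsilon> by (simp add: K_def)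
    have "\<bar>u y0 - u x0\<bar> < \<theta> / 4" "\<bar>v q0 - v x0\<bar> < \<theta> / 4"
      using d1(2)[OF x0 P0(2)] d2(2)[OF x0 P0(3)] P0 \<epsilon> by auto
    moreover have "\<theta> \<le> u y0 - v q0" using max[OF xmP] by (simp add: \<theta>_def)
    ultimately have "\<theta> / 2 \<le> u x0 - v x0" by linarith
    moreover have "x0 \<in> closure \<Omega>" using x0 K\<Omega> sub by blast
    ultimately show ?thesis by (simp add: N_def)
  qed
  have inK: "y \<in> K r" if "dist y x0 \<le> r" "r \<ge> 0" for y r
    using Kadd[OF K0[OF x0N order_refl] that(1)] by simp
  have ball: "cball x0 (2 * \<epsilon>) \<subseteq> K \<rho>"
    using inK[of _ \<rho>] \<epsilon> by (auto simp: dist_commute)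
  define w where "w x = - v x" for x
  have cont2: "continuous_on (cball x0 (2 * \<epsilon>)) u" "continuous_on (cball x0 (2 * \<epsilon>)) w"
    unfolding w_def
    by (intro continuous_on_minus continuous_on_subset[OF contK(1) ball]
        continuous_on_subset[OF contK(2) ball])+
  have yq0: "y0 \<in> cball x0 \<epsilon>" "q0 \<in> cball x0 \<epsilon>" using P0 by (auto simp: dist_commute)
  have max': "u y + w q \<le> u y0 + w q0" if "dist x x0 \<le> \<epsilon>" "dist y x \<le> \<epsilon>" "dist q x \<le> \<epsilon>" for x y q
  proof -
    have "x \<in> K \<epsilon>" using inK that(1) \<epsilon> by simp
    moreover from this have "y \<in> K (\<epsilon> + \<epsilon>)" "q \<in> K (\<epsilon> + \<epsilon>)" using Kadd that by blast+
    ultimately have "(x, y, q) \<in> P" using that \<epsilon>(6) by (simp add: P_def K_def)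
    from max[OF this] show ?thesis by (simp add: w_def)
  qed
  obtain y2 q2 where y2q2:
    "\<And>x. x \<in> cball x0 (2 * \<epsilon>) \<Longrightarrow> u x \<le> u y2" "\<And>x. x \<in> cball x0 (2 * \<epsilon>) \<Longrightarrow> w x \<le> w q2"
    "u y2 - u y0 \<le> w q0 - w x0" "w q2 - w q0 \<le> u y0 - u x0"
  proof (rule enveloped_difference_max[OF cont2 \<epsilon>(1) yq0])
    show "u y + w q \<le> u y0 + w q0" if "dist x x0 \<le> \<epsilon>" "dist y x \<le> \<epsilon>" "dist q x \<le> \<epsilon>" for x y q
      by (rule max'[OF that])
  qed (rule that)
  define lo where "lo = gv x0 + \<eta> / 4"
  define hi where "hi = gu x0 - \<eta> / 4"
  have "\<eta> \<le> gu x0 - gv x0" using xn(2)[OF x0N] by (simp only: \<eta>_def)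
  then have "lo < hi" using \<eta> unfolding lo_def hi_def by argo
  have near: "hi \<le> gu x" "gv x \<le> lo" if "x \<in> ball x0 (2 * \<epsilon>)" for x
  proof -
    have x: "x \<in> K \<rho>" "x0 \<in> K \<rho>" "dist x x0 < d3" "dist x x0 < d4"
      using that ball \<epsilon> K0[OF x0N, of \<rho>] \<rho>(1) by (auto simp: dist_commute)
    then have "\<bar>gu x - gu x0\<bar> < \<eta> / 4" "\<bar>gv x - gv x0\<bar> < \<eta> / 4"
      using d3(2)[OF x(2,1)] d4(2)[OF x(2,1)] by auto
    then have "- (gu x - gu x0) < \<eta> / 4" "gv x - gv x0 < \<eta> / 4"
      unfolding abs_less_iff by blast+
    then show "hi \<le> gu x" "gv x \<le> lo" unfolding lo_def hi_def by argo+
  qed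
  have B: "ball x0 (2 * \<epsilon>) \<subseteq> \<Omega>" using ball K\<Omega> ball_subset_cball by blast
  have ge_u: "inf_laplacian_ge (ball x0 (2 * \<epsilon>)) u hi"
    using near by (intro inf_laplacian_ge_if_subsolution[OF assms(17) open_ball B]) (simp add: gu_def)
  have ge_w: "inf_laplacian_ge (ball x0 (2 * \<epsilon>)) w (- lo)"
    unfolding w_def using near
    by (intro inf_laplacian_ge_if_supersolution[OF assms(18) open_ball B]) (simp add: gv_def)
  \<comment> \<open>A nonzero constant strictly between \<open>lo\<close> and \<open>hi\<close>: the midpoint, unless it is zero.\<close>
  obtain c where c: "lo < c" "c < hi" "c \<noteq> 0"
  proof (cases "(lo + hi) / 2 = 0")
    case True
    then show ?thesis using that[of "(lo + 3 * hi) / 4"] \<open>lo < hi\<close> by auto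
  next
    case False
    then show ?thesis using that[of "(lo + hi) / 2"] \<open>lo < hi\<close> by auto
  qed
  show False
  proof (cases "c > 0")
    case True
    show False
      by (rule increments_not_dominated[OF ge_u cont2(1) ge_w cont2(2) c(2) _ True \<epsilon>(1) yq0(1) y2q2(1) yq0(2) y2q2(2,3,4)])
        (use c in auto)
  next
    case False
    \<comment> \<open>For \<open>c < 0\<close> the functions \<open>u\<close> and \<open>w\<close> exchange their roles.\<close>
    show False
      by (rule increments_not_dominated[OF ge_w cont2(2) ge_u cont2(1) _ _ _ \<epsilon>(1) yq0(2) y2q2(2) yq0(1) y2q2(1,4,3), of "- c"])
        (use c False in auto)
  qed
qed

end
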